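(* Monomial curves in $\mathbb{A}^4$ may have arbitrarily large Markov complexity: for every $d\in\mathbb{N}$ there exists a monomial curve $\mathcal{A}=(a_1,a_2,a_3,a_4)$ in $\mathbb{A}^4$ whose Markov complexity satisfies $m(\mathcal{A})>d$. Equivalently, there is no $d\in\mathbb{N}$ such that $m(\mathcal{A})\le d$ for all monomial curves $\mathcal{A}$ in $\mathbb{A}^4$.
   Context: A monomial curve in $\mathbb{A}^n$ is given by $n$ distinct positive integers $\mathcal{A}=(a_1,\dots,a_n)$, regarded as a $1\times n$ integer matrix $A$. For an integer matrix $M$ with $N$ columns and nonnegative entries such that $\ker_{\mathbb{Z}}(M)\cap\mathbb{N}^N=\{0\}$ (here $0\in\mathbb{N}$), a Markov basis of $M$ is a finite subset $\mathcal{M}\subset\ker_{\mathbb{Z}}(M)$ such that for all $w,u\in\mathbb{N}^N$ with $w-u\in\ker_{\mathbb{Z}}(M)$ there is a finite sequence $v_1,\dots,v_s$ of elements which up to sign belong to $\mathcal{M}$ (repetitions allowed), with $w-u=\sum_{i=1}^s v_i$ and $w-\sum_{i=1}^p v_i\in\mathbb{N}^N$ for all $1\le p\le s$. A Markov basis is minimal if no proper subset of it is a Markov basis. The universal Markov basis of $M$ is the union of all minimal Markov bases of $M$, where elements differing by a sign are identified. For $r\ge 2$ the $r$-th Lawrence lifting $A^{(r)}$ of an $m\times n$ matrix $A$ is the $(rm+n)\times rn$ matrix whose first $rm$ rows form the block diagonal matrix with $r$ diagonal blocks equal to $A$, and whose last $n$ rows are $(I_n\ I_n\ \cdots\ I_n)$.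 An element of $\ker_{\mathbb{Z}}(A^{(r)})$ is identified with an $r\times n$ integer matrix each of whose rows lies in $\ker_{\mathbb{Z}}(A)$ and whose rows sum to zero. The type of such an element is the number of its nonzero rows. The Markov complexity $m(\mathcal{A})$ is the largest type of any element of the universal Markov basis of $A^{(r)}$, as $r\ge2$ varies. *)

theory Defs
  imports
    "Jordan_Normal_Form.Matrix_Kernel"
    "HOL-Library.Extended_Nat"
begin

text \<open>
  The order on \<open>int vec\<close> is componentwise and includes equality of dimensions, so
  \<open>0\<^sub>v N \<le> u\<close> says that \<open>u\<close> is a nonnegative integer vector of dimension \<open>N\<close>.
  The walk \<open>vs\<close> may be empty; this is needed for \<open>w = u\<close>, since otherwise every Markov
  basis would have to contain the zero vector.
  The standing hypotheses on \<open>M\<close> (nonnegative entries, no nonzero nonnegative vector in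
  the kernel) are not repeated here; they hold for all Lawrence liftings used below.
\<close>

definition markov_basis :: "int mat \<Rightarrow> int vec set \<Rightarrow> bool" where
  "markov_basis M B \<longleftrightarrow>
     finite B \<and> B \<subseteq> mat_kernel M \<and>
     (\<forall>w u. 0\<^sub>v (dim_col M) \<le> w \<longrightarrow> 0\<^sub>v (dim_col M) \<le> u \<longrightarrow> w - u \<in> mat_kernel M \<longrightarrow>
       (\<exists>vs. (\<forall>v \<in> set vs. v \<in> B \<or> - v \<in> B) \<and>
             w - u = foldr (+) vs (0\<^sub>v (dim_col M)) \<and>
             (\<forall>p \<in> {1..length vs}.
                0\<^sub>v (dim_col M) \<le> w - foldr (+) (take p vs) (0\<^sub>v (dim_col M)))))"

definition minimal_markov_basis :: "int mat \<Rightarrow> int vec set \<Rightarrow> bool" where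
  "minimal_markov_basis M B \<longleftrightarrow>
     markov_basis M B \<and> (\<forall>B'. B' \<subset> B \<longrightarrow> \<not> markov_basis M B')"

text \<open>
  Replacing an element of a minimal Markov basis by its negative gives a minimal Markov
  basis, so this union is closed under negation. Instead of identifying \<open>v\<close> with
  \<open>- v\<close>, both are kept; they have the same type.
\<close>

definition universal_markov_basis :: "int mat \<Rightarrow> int vec set" where
  "universal_markov_basis M = \<Union> {B. minimal_markov_basis M B}"

definition lawrence_lifting :: "nat \<Rightarrow> int mat \<Rightarrow> int mat" where
  "lawrence_lifting r A =
     diag_block_mat (replicate r A) @\<^sub>r
     mat (dim_col A) (r * dim_col A) (\<lambda>(i, j). if j mod dim_col A = i then 1 else 0)"

text \<open>
  A vector of dimension \<open>r * n\<close> is read as an \<open>r \<times> n\<close> matrix: its \<open>i\<close>-th row is the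
  \<open>i\<close>-th block of \<open>n\<close> consecutive entries.
\<close>

definition vec_as_mat :: "nat \<Rightarrow> nat \<Rightarrow> int vec \<Rightarrow> int mat" where
  "vec_as_mat r n v = mat r n (\<lambda>(i, j). v $ (i * n + j))"

definition lawrence_type :: "nat \<Rightarrow> nat \<Rightarrow> int vec \<Rightarrow> nat" where
  "lawrence_type r n v = card {i. i < r \<and> row (vec_as_mat r n v) i \<noteq> 0\<^sub>v n}"

text \<open>
  The supremum is taken in \<open>enat\<close>, so that no finiteness result is built into the
  definition; when the types are bounded it is their maximum.
\<close>

definition markov_complexity :: "int mat \<Rightarrow> enat" where
  "markov_complexity A =
     Sup {enat (lawrence_type r (dim_col A) v) | r v.
            2 \<le> r \<and> v \<in> universal_markov_basis (lawrence_lifting r A)}"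

definition monomial_curve :: "nat \<Rightarrow> int list \<Rightarrow> bool" where
  "monomial_curve n a \<longleftrightarrow> length a = n \<and> distinct a \<and> (\<forall>x \<in> set a. 0 < x)"

definition curve_matrix :: "int list \<Rightarrow> int mat" where
  "curve_matrix a = mat_of_rows_list (length a) [a]"

end

theory Submission
  imports Defs
begin

text \<open>
  The fiber of a nonnegative vector \<open>p\<close> is the set of nonnegative vectors congruent to it
  modulo the kernel. If it consists of \<open>p\<close> and one further vector \<open>u\<close>, then a walk from
  \<open>p\<close> to \<open>u\<close> has nowhere else to go and must use the move \<open>p - u\<close>, so every Markov basis
  contains \<open>p - u\<close> up to sign (\<open>two_element_fiber_in_markov_basis\<close>). Minimal Markov bases
  exist (\<open>minimal_markov_basis_exists\<close>), so the type of such a \<open>p - u\<close> bounds the Markov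
  complexity from below.

  Two-element fibers of a Lawrence lifting \<open>A\<^sup>(\<^sup>r\<^sup>)\<close> are obtained from those of \<open>A\<close>: stack
  \<open>r\<close> kernel elements of \<open>A\<close>, each coming from a two-element fiber, that sum to zero while no
  proper nonempty subfamily does. A vector in the fiber of the stacked matrix is given by the set
  of rows that are moved to the other point of their fiber; since column sums are preserved, the
  moves of these rows sum to zero, so either no row is moved or all are
  (\<open>two_element_fiber_lawrence_lifting\<close>).

  It remains to find curves with long minimal zero sums of this kind. Bresinsky's curves
  \<open>(q(q+1), (q-1)(q+1), q(q+1)+(q-1), q(q-1))\<close> with \<open>q\<close> even have the kernel elements
  \<open>e = (1,1,-1,-1)\<close> and \<open>g\<^sub>i = (q-1-i, -i, i, -(q+1)+i)\<close> for \<open>1 \<le> i \<le> q-1\<close>, and all of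
  them come from two-element fibers (\<open>bresinsky_fiber\<close>, \<open>bresinsky_quadric_fiber\<close>). The
  \<open>g\<^sub>i\<close> form an arithmetic progression with difference \<open>-e\<close>, so
  \<open>g\<^sub>1 - g\<^bsub>q-1\<^esub> - e - \<dots> - e = 0\<close> with \<open>q - 2\<close> copies of \<open>e\<close>. This zero sum of
  \<open>q\<close> terms is minimal, and it gives an element of type \<open>q\<close>.
\<close>

section \<open>Existence of minimal Markov bases\<close>

lemma incseq_subsequence_nat:
  fixes s :: "nat \<Rightarrow> nat"
  shows "\<exists>k::nat \<Rightarrow> nat. strict_mono k \<and> incseq (\<lambda>n. s (k n))"
proof -
  obtain k :: "nat \<Rightarrow> nat" where k: "strict_mono k" "monoseq (\<lambda>n. s (k n))"
    using seq_monosub[of s] by blast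
  show ?thesis
  proof (cases "incseq (\<lambda>n. s (k n))")
    case True
    with k show ?thesis by blast
  next
    case False
    then have dec: "decseq (\<lambda>n. s (k n))" using k(2) by (simp add: monoseq_iff)
    obtain m where m: "\<And>n. s (k m) \<le> s (k n)"
      using ex_has_least_nat[of "\<lambda>_. True" 0 "\<lambda>n. s (k n)"] by auto
    have const: "s (k (m + n)) = s (k m)" for n
      using m[of "m + n"] decseqD[OF dec, of m "m + n"] by simp
    have "strict_mono (\<lambda>n. k (m + n))"
      using k(1) by (simp add: strict_mono_def)
    moreover have "incseq (\<lambda>n. s (k (m + n)))" by (simp add: const incseq_def)
    ultimately show ?thesis by blast
  qed
qed

lemma incseq_subsequence_coordinates:
  fixes f :: "nat \<Rightarrow> 'i \<Rightarrow> nat"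
  assumes "finite I"
  shows "\<exists>h::nat \<Rightarrow> nat. strict_mono h \<and> (\<forall>i\<in>I. incseq (\<lambda>n. f (h n) i))"
  using assms
proof (induction I rule: finite_induct)
  case empty
  show ?case by (rule exI[of _ id]) (simp add: strict_mono_def)
next
  case (insert i I)
  then obtain h :: "nat \<Rightarrow> nat" where h: "strict_mono h" "\<forall>i\<in>I. incseq (\<lambda>n. f (h n) i)" by blast
  obtain k :: "nat \<Rightarrow> nat" where k: "strict_mono k" "incseq (\<lambda>n. f (h (k n)) i)"
    using incseq_subsequence_nat[of "\<lambda>n. f (h n) i"] by blast
  have "strict_mono (\<lambda>n. h (k n))" using h(1) k(1) by (simp add: strict_mono_def)
  moreover have "incseq (\<lambda>n. f (h (k n)) j)" if "j \<in> I" for j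
    using h(2) that k(1) by (auto simp: incseq_def strict_mono_less_eq)
  ultimately show ?case using k(2) by (intro exI[of _ "\<lambda>n. h (k n)"]) auto
qed

text \<open>
  This is Dickson's lemma: an infinite set would contain a sequence of distinct elements, and a
  subsequence on which every coordinate is nondecreasing has comparable members.
\<close>

lemma finite_antichain:
  fixes c :: "'a \<Rightarrow> 'i \<Rightarrow> nat"
  assumes I: "finite I"
    and anti: "\<And>x y. x \<in> X \<Longrightarrow> y \<in> X \<Longrightarrow> (\<And>i. i \<in> I \<Longrightarrow> c x i \<le> c y i) \<Longrightarrow> x = y"
  shows "finite X"
proof (rule ccontr)
  assume "infinite X"
  then obtain f :: "nat \<Rightarrow> 'a" where f: "inj f" "range f \<subseteq> X"
    using infinite_countable_subset by blast
  obtain h :: "nat \<Rightarrow> nat" where h: "strict_mono h" "\<forall>i\<in>I. incseq (\<lambda>n. c (f (h n)) i)"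
    using incseq_subsequence_coordinates[OF I, of "\<lambda>n. c (f n)"] by blast
  have "f (h 0) = f (h 1)"
    using f(2) h(2) by (intro anti) (auto simp: incseq_def)
  moreover have "h 0 < h 1" using h(1) by (simp add: strict_mono_def)
  ultimately show False using f(1) by (auto dest: injD)
qed

lemma mem_mat_kernel_iff:
  "x \<in> mat_kernel M \<longleftrightarrow> dim_vec x = dim_col M \<and> (\<forall>k<dim_row M. (M *\<^sub>v x) $ k = 0)"
proof -
  have "M *\<^sub>v x = 0\<^sub>v (dim_row M) \<longleftrightarrow> (\<forall>k<dim_row M. (M *\<^sub>v x) $ k = 0)" (is "?eq \<longleftrightarrow> ?all")
  proof
    show ?eq if ?all
      using that by (intro eq_vecI) (auto simp del: index_mult_mat_vec)
    show ?all if ?eq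
      unfolding that by simp
  qed
  then show ?thesis unfolding mat_kernel_def carrier_vec_def by blast
qed

lemma mat_kernel_diff:
  assumes "x \<in> mat_kernel M" "y \<in> mat_kernel M"
  shows "x - y \<in> mat_kernel (M :: int mat)"
  using assms unfolding mat_kernel_def
  by (auto simp: mult_minus_distrib_mat_vec[of M "dim_row M" "dim_col M"])

lemma mat_kernel_uminus:
  assumes "x \<in> mat_kernel M"
  shows "- x \<in> mat_kernel (M :: int mat)"
proof -
  have "x - x - x \<in> mat_kernel M" by (intro mat_kernel_diff assms)
  moreover have "x - x - x = - x" by (intro eq_vecI) auto
  ultimately show ?thesis by simp
qed

lemma foldr_add_dim_vec [simp]:
  "dim_vec (foldr (+) vs (0\<^sub>v N :: int vec)) = N"
  by (induction vs) auto

text \<open>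
  A finite Markov basis is built from pairs \<open>(w, u)\<close> instead of differences \<open>w - u\<close>: the
  congruent pairs form a monoid that is closed under those differences that stay nonnegative, and
  Dickson's lemma applies to its minimal nonzero elements.
\<close>

definition congruent_pairs :: "int mat \<Rightarrow> (int vec \<times> int vec) set" where
  "congruent_pairs M = {(w, u). 0\<^sub>v (dim_col M) \<le> w \<and> 0\<^sub>v (dim_col M) \<le> u \<and> w - u \<in> mat_kernel M}"

definition minimal_pairs :: "int mat \<Rightarrow> (int vec \<times> int vec) set" where
  "minimal_pairs M = {(a, b) \<in> congruent_pairs M.
     (a, b) \<noteq> (0\<^sub>v (dim_col M), 0\<^sub>v (dim_col M)) \<and>
     (\<forall>(a', b') \<in> congruent_pairs M. a' \<le> a \<longrightarrow> b' \<le> b \<longrightarrow>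
        (a', b') = (0\<^sub>v (dim_col M), 0\<^sub>v (dim_col M)) \<or> (a', b') = (a, b))}"

lemma finite_minimal_pairs: "finite (minimal_pairs M)"
proof (rule finite_antichain[where I = "{..<dim_col M} \<times> (UNIV :: bool set)"
      and c = "\<lambda>(a, b) (i, t). nat ((if t then a else b) $ i)"])
  show "finite ({..<dim_col M} \<times> (UNIV :: bool set))" by simp
  fix x y
  assume xy: "x \<in> minimal_pairs M" "y \<in> minimal_pairs M"
    and le: "\<And>it. it \<in> {..<dim_col M} \<times> (UNIV :: bool set) \<Longrightarrow>
      (case x of (a, b) \<Rightarrow> \<lambda>(i, t). nat ((if t then a else b) $ i)) it
      \<le> (case y of (a, b) \<Rightarrow> \<lambda>(i, t). nat ((if t then a else b) $ i)) it"
  obtain a b a' b' where [simp]: "x = (a, b)" "y = (a', b')" by force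
  have nn: "0\<^sub>v (dim_col M) \<le> a" "0\<^sub>v (dim_col M) \<le> b" "0\<^sub>v (dim_col M) \<le> a'" "0\<^sub>v (dim_col M) \<le> b'"
    using xy by (auto simp: minimal_pairs_def congruent_pairs_def)
  have "a $ i \<le> a' $ i" "b $ i \<le> b' $ i" if "i < dim_col M" for i
    using le[of "(i, True)"] le[of "(i, False)"] nn that by (auto simp: less_eq_vec_def nat_le_eq_zle)
  then have "a \<le> a'" "b \<le> b'" using nn by (auto simp: less_eq_vec_def)
  then show "x = y" using xy by (auto simp: minimal_pairs_def)
qed

lemma sum_entries_less:
  fixes a a' :: "int vec"
  assumes "a' \<le> a" "a' \<noteq> a"
  shows "sum (($) a') {..<dim_vec a} < sum (($) a) {..<dim_vec a}"
proof (rule sum_strict_mono_ex1)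
  have "\<exists>i<dim_vec a. a' $ i \<noteq> a $ i"
    using assms by (auto simp: less_eq_vec_def intro!: eq_vecI)
  then show "\<exists>i\<in>{..<dim_vec a}. a' $ i < a $ i"
    using assms(1) by (force simp: less_eq_vec_def)
qed (use assms in \<open>auto simp: less_eq_vec_def\<close>)

definition pair_size :: "int vec \<times> int vec \<Rightarrow> nat" where
  "pair_size = (\<lambda>(a, b). nat (sum (($) a) {..<dim_vec a}) + nat (sum (($) b) {..<dim_vec b}))"

lemma pair_size_less:
  assumes "0\<^sub>v N \<le> a'" "0\<^sub>v N \<le> b'" "a' \<le> a" "b' \<le> b" "(a', b') \<noteq> (a, b)"
  shows "pair_size (a', b') < pair_size (a, b)"
proof -
  have nn: "0 \<le> sum (($) a') {..<dim_vec a'}" "0 \<le> sum (($) b') {..<dim_vec b'}"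
    using assms(1,2) by (auto simp: less_eq_vec_def intro!: sum_nonneg)
  have d: "dim_vec a' = dim_vec a" "dim_vec b' = dim_vec b"
    using assms(3,4) by (auto simp: less_eq_vec_def)
  have "sum (($) a') {..<dim_vec a} < sum (($) a) {..<dim_vec a} \<or> a' = a"
       "sum (($) b') {..<dim_vec b} < sum (($) b) {..<dim_vec b} \<or> b' = b"
    using sum_entries_less assms(3,4) by blast+
  then show ?thesis using nn assms(5) by (auto simp: pair_size_def d)
qed

lemma minimal_pair_below:
  assumes "(w, u) \<in> congruent_pairs M" "(w, u) \<noteq> (0\<^sub>v (dim_col M), 0\<^sub>v (dim_col M))"
  shows "\<exists>(a, b) \<in> minimal_pairs M. a \<le> w \<and> b \<le> u"
proof -
  let ?Q = "\<lambda>(a, b). (a, b) \<in> congruent_pairs M \<and> (a, b) \<noteq> (0\<^sub>v (dim_col M), 0\<^sub>v (dim_col M))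
     \<and> a \<le> w \<and> b \<le> u"
  have "?Q (w, u)" using assms by auto
  then obtain ab where Q: "?Q ab" and least: "\<And>y. ?Q y \<Longrightarrow> pair_size ab \<le> pair_size y"
    using ex_has_least_nat[of ?Q "(w, u)" pair_size] by blast
  obtain a b where [simp]: "ab = (a, b)" by force
  have "(a', b') = (0\<^sub>v (dim_col M), 0\<^sub>v (dim_col M)) \<or> (a', b') = (a, b)"
    if c: "(a', b') \<in> congruent_pairs M" and le: "a' \<le> a" "b' \<le> b" for a' b'
  proof (rule ccontr)
    assume n: "\<not> ?thesis"
    have "?Q (a', b')" using Q c le n by (auto intro: order_trans)
    then have "pair_size (a, b) \<le> pair_size (a', b')" using least by simp
    moreover have "pair_size (a', b') < pair_size (a, b)"
      using c le n by (intro pair_size_less[of "dim_col M"]) (auto simp: congruent_pairs_def)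
    ultimately show False by simp
  qed
  then have "(a, b) \<in> minimal_pairs M" using Q by (auto simp: minimal_pairs_def)
  then show ?thesis using Q by auto
qed

text \<open>
  Write \<open>(w, u)\<close> as a sum of minimal pairs \<open>(a, b)\<close> and replace the summands \<open>a\<close> of \<open>w\<close> by
  the corresponding \<open>b\<close> one after the other. Every intermediate vector is a sum of nonnegative
  vectors, some of them \<open>a\<close>'s and some \<open>b\<close>'s.
\<close>

lemma walk_by_minimal_pairs:
  assumes "(w, u) \<in> congruent_pairs M"
  shows "\<exists>vs. set vs \<subseteq> (\<lambda>(a, b). a - b) ` minimal_pairs M \<and>
             w - u = foldr (+) vs (0\<^sub>v (dim_col M)) \<and>
             (\<forall>p \<in> {1..length vs}. 0\<^sub>v (dim_col M) \<le> w - foldr (+) (take p vs) (0\<^sub>v (dim_col M)))"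
  using assms
proof (induction "pair_size (w, u)" arbitrary: w u rule: less_induct)
  case less
  let ?N = "dim_col M"
  show ?case
  proof (cases "(w, u) = (0\<^sub>v ?N, 0\<^sub>v ?N)")
    case True
    then show ?thesis by (intro exI[of _ "[]"]) auto
  next
    case False
    obtain a b where ab: "(a, b) \<in> minimal_pairs M" "a \<le> w" "b \<le> u"
      using minimal_pair_below[OF less.prems False] by blast
    have abc: "(a, b) \<in> congruent_pairs M" "(a, b) \<noteq> (0\<^sub>v ?N, 0\<^sub>v ?N)"
      using ab(1) by (auto simp: minimal_pairs_def)
    have nn: "0\<^sub>v ?N \<le> a" "0\<^sub>v ?N \<le> b" "0\<^sub>v ?N \<le> w" "0\<^sub>v ?N \<le> u"
      using abc less.prems by (auto simp: congruent_pairs_def)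
    have d: "dim_vec a = ?N" "dim_vec b = ?N" "dim_vec w = ?N" "dim_vec u = ?N"
      using nn by (auto simp: less_eq_vec_def)
    have eq: "(w - a) - (u - b) = (w - u) - (a - b)"
      by (intro eq_vecI) (auto simp: d)
    have c': "(w - a, u - b) \<in> congruent_pairs M"
      using ab nn abc less.prems mat_kernel_diff[of "w - u" M "a - b"]
      by (auto simp: congruent_pairs_def eq less_eq_vec_def)
    have "pair_size (w - a, u - b) < pair_size (w, u)"
    proof (rule pair_size_less[of ?N])
      show "w - a \<le> w" "u - b \<le> u" using nn by (auto simp: less_eq_vec_def)
      show "0\<^sub>v ?N \<le> w - a" "0\<^sub>v ?N \<le> u - b" using c' by (auto simp: congruent_pairs_def)
      show "(w - a, u - b) \<noteq> (w, u)"
      proof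
        assume "(w - a, u - b) = (w, u)"
        then have "\<forall>i<?N. (w - a) $ i = w $ i" "\<forall>i<?N. (u - b) $ i = u $ i" by auto
        then have "a = 0\<^sub>v ?N" "b = 0\<^sub>v ?N" by (auto intro!: eq_vecI simp: d)
        then show False using abc by simp
      qed
    qed
    from less.hyps[OF this c'] obtain vs where
      vs: "set vs \<subseteq> (\<lambda>(a, b). a - b) ` minimal_pairs M"
      "w - a - (u - b) = foldr (+) vs (0\<^sub>v ?N)"
      "\<forall>p \<in> {1..length vs}. 0\<^sub>v ?N \<le> w - a - foldr (+) (take p vs) (0\<^sub>v ?N)" by blast
    have vs3: "0\<^sub>v ?N \<le> w - a - foldr (+) (take p vs) (0\<^sub>v ?N)" if "p \<le> length vs" for p
      using vs(3) that c' by (cases p) (auto simp: congruent_pairs_def less_eq_vec_def d)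
    have "w - u = (a - b) + (w - a - (u - b))" by (intro eq_vecI) (auto simp: d)
    then have sum: "w - u = foldr (+) ((a - b) # vs) (0\<^sub>v ?N)" using vs(2) by simp
    have pre: "0\<^sub>v ?N \<le> w - foldr (+) (take p ((a - b) # vs)) (0\<^sub>v ?N)"
      if p: "p \<in> {1..length ((a - b) # vs)}" for p
    proof -
      obtain p' where p': "p = Suc p'" "p' \<le> length vs" using p by (cases p) auto
      show ?thesis
        using vs3[OF p'(2)] nn(2) by (fastforce simp: p'(1) less_eq_vec_def d)
    qed
    show ?thesis
      by (rule exI[of _ "(a - b) # vs"]) (use ab(1) vs(1) sum pre in auto)
  qed
qed

lemma finite_markov_basis_exists: "\<exists>B. markov_basis M B"
proof
  show "markov_basis M ((\<lambda>(a, b). a - b) ` minimal_pairs M)"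
    unfolding markov_basis_def
  proof (intro conjI allI impI)
    fix w u
    assume "0\<^sub>v (dim_col M) \<le> w" "0\<^sub>v (dim_col M) \<le> u" "w - u \<in> mat_kernel M"
    then have "(w, u) \<in> congruent_pairs M" by (simp add: congruent_pairs_def)
    from walk_by_minimal_pairs[OF this]
    show "\<exists>vs. (\<forall>v \<in> set vs. v \<in> (\<lambda>(a, b). a - b) ` minimal_pairs M
              \<or> - v \<in> (\<lambda>(a, b). a - b) ` minimal_pairs M) \<and>
             w - u = foldr (+) vs (0\<^sub>v (dim_col M)) \<and>
             (\<forall>p \<in> {1..length vs}.
                0\<^sub>v (dim_col M) \<le> w - foldr (+) (take p vs) (0\<^sub>v (dim_col M)))"
      by blast
  next
    show "finite ((\<lambda>(a, b). a - b) ` minimal_pairs M)" by (intro finite_imageI finite_minimal_pairs)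
  qed (auto simp: minimal_pairs_def congruent_pairs_def)
qed

lemma minimal_markov_basis_exists: "\<exists>B. minimal_markov_basis M B"
proof -
  obtain B0 where B0: "markov_basis M B0" using finite_markov_basis_exists by blast
  then obtain B where B: "markov_basis M B" and least: "\<And>C. markov_basis M C \<Longrightarrow> card B \<le> card C"
    using ex_has_least_nat[of "markov_basis M" B0 card] by blast
  have "\<not> markov_basis M C" if "C \<subset> B" for C
  proof -
    have "card C < card B" using B that by (intro psubset_card_mono) (auto simp: markov_basis_def)
    then show ?thesis using least[of C] by (meson not_le)
  qed
  then show ?thesis using B by (auto simp: minimal_markov_basis_def)
qed

section \<open>Two-element fibers\<close>

definition fiber :: "int mat \<Rightarrow> int vec \<Rightarrow> int vec set" where
  "fiber M x = {y. 0\<^sub>v (dim_col M) \<le> y \<and> x - y \<in> mat_kernel M}"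

text \<open>
  The first nonzero step of a walk from \<open>p\<close> to \<open>u\<close> leaves \<open>p\<close> inside the fiber, hence
  arrives at \<open>u\<close>. Zero steps have to be skipped, because a Markov basis may contain the zero
  vector.
\<close>

lemma two_element_fiber_in_markov_basis:
  assumes B: "markov_basis M B"
    and p: "0\<^sub>v (dim_col M) \<le> p" and ne: "p \<noteq> u"
    and fib: "fiber M p = {p, u}"
  shows "p - u \<in> B \<or> - (p - u) \<in> B"
proof -
  let ?N = "dim_col M"
  have u: "0\<^sub>v ?N \<le> u" and ker: "p - u \<in> mat_kernel M" using fib by (auto simp: fiber_def)
  have d: "dim_vec p = ?N" "dim_vec u = ?N" using p u by (auto simp: less_eq_vec_def)
  have Bker: "B \<subseteq> mat_kernel M" using B by (simp add: markov_basis_def)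
  obtain vs where vs: "\<forall>v \<in> set vs. v \<in> B \<or> - v \<in> B"
     "p - u = foldr (+) vs (0\<^sub>v ?N)"
     "\<forall>k \<in> {1..length vs}. 0\<^sub>v ?N \<le> p - foldr (+) (take k vs) (0\<^sub>v ?N)"
    using B p u ker unfolding markov_basis_def by metis
  from vs show ?thesis
  proof (induction vs)
    case Nil
    then have "(p - u) $ i = 0" if "i < ?N" for i using that by simp
    then have "p = u" by (intro eq_vecI) (auto simp: d)
    then show ?case using ne by simp
  next
    case (Cons v vs)
    have "v \<in> B \<or> - v \<in> B" using Cons.prems(1) by simp
    then have "v \<in> mat_kernel M" using Bker mat_kernel_uminus[of "- v" M] by auto
    then have dv: "dim_vec v = ?N" by (auto simp: mat_kernel_def)
    have "0\<^sub>v ?N \<le> p - v"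
      using bspec[OF Cons.prems(3), of 1] dv by (auto simp: less_eq_vec_def)
    moreover have "p - (p - v) = v" by (intro eq_vecI) (auto simp: d dv)
    ultimately have "p - v \<in> fiber M p" using \<open>v \<in> mat_kernel M\<close> by (simp add: fiber_def)
    then consider "p - v = p" | "p - v = u" using fib by auto
    then show ?case
    proof cases
      case 1
      then have "\<forall>i<?N. (p - v) $ i = p $ i" by simp
      then have v0: "v = 0\<^sub>v ?N" by (intro eq_vecI) (auto simp: dv)
      have z: "0\<^sub>v ?N + foldr (+) xs (0\<^sub>v ?N) = foldr (+) xs (0\<^sub>v ?N)" for xs :: "int vec list"
        by (intro eq_vecI) auto
      show ?thesis
      proof (rule Cons.IH)
        show "\<forall>v\<in>set vs. v \<in> B \<or> - v \<in> B" using Cons.prems(1) by simp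
        show "p - u = foldr (+) vs (0\<^sub>v ?N)" using Cons.prems(2) by (simp add: v0 z)
        show "\<forall>k\<in>{1..length vs}. 0\<^sub>v ?N \<le> p - foldr (+) (take k vs) (0\<^sub>v ?N)"
        proof
          fix k assume "k \<in> {1..length vs}"
          then show "0\<^sub>v ?N \<le> p - foldr (+) (take k vs) (0\<^sub>v ?N)"
            using bspec[OF Cons.prems(3), of "Suc k"] by (simp add: v0 z)
        qed
      qed
    next
      case 2
      then have "v = p - u" using \<open>p - (p - v) = v\<close> by simp
      then show ?thesis using \<open>v \<in> B \<or> - v \<in> B\<close> by simp
    qed
  qed
qed

section \<open>Lawrence liftings\<close>

definition block :: "nat \<Rightarrow> int vec \<Rightarrow> nat \<Rightarrow> int vec" where
  "block n x i = vec n (\<lambda>j. x $ (i * n + j))"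

definition vec_of_blocks :: "nat \<Rightarrow> nat \<Rightarrow> (nat \<Rightarrow> int vec) \<Rightarrow> int vec" where
  "vec_of_blocks r n f = vec (r * n) (\<lambda>k. f (k div n) $ (k mod n))"

lemma block_index_less: "i < r \<Longrightarrow> j < n \<Longrightarrow> i * n + j < r * (n::nat)"
proof -
  assume "i < r" "j < n"
  then have "i * n + j < Suc i * n" by simp
  also have "\<dots> \<le> r * n" using \<open>i < r\<close> by (intro mult_le_mono1) simp
  finally show ?thesis .
qed

lemma block_index_div: "k < r * n \<Longrightarrow> k div n < r \<and> k mod n < (n::nat)"
  using less_mult_imp_div_less[of k r n] by (cases "n = 0") auto

lemma vec_of_blocks_index [simp]:
  "i < r \<Longrightarrow> j < n \<Longrightarrow> vec_of_blocks r n f $ (i * n + j) = f i $ j"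
  using block_index_less[of i r j n] by (simp add: vec_of_blocks_def)

lemma dim_vec_of_blocks [simp]: "dim_vec (vec_of_blocks r n f) = r * n"
  by (simp add: vec_of_blocks_def)

lemma diag_block_mat_replicate_index:
  assumes A: "A \<in> carrier_mat m n" and "i < r * m" "k < r * n"
  shows "diag_block_mat (replicate r A) $$ (i, k)
         = (if i div m = k div n then A $$ (i mod m, k mod n) else (0::int))"
  using assms(2,3)
proof (induction r arbitrary: i k)
  case 0
  then show ?case by simp
next
  case (Suc r)
  let ?D = "diag_block_mat (replicate r A)"
  have dims: "dim_row ?D = r * m" "dim_col ?D = r * n" "dim_row A = m" "dim_col A = n"
    using A by (auto simp: dim_diag_block_mat sum_list_replicate)
  have "0 < m" "0 < n" using Suc.prems by (auto intro: gr0I)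
  then show ?case
    using Suc.prems Suc.IH[of "i - m" "k - n"]
    by (auto simp: Let_def dims le_div_geq le_mod_geq not_less)
qed

lemma lawrence_lifting_dims [simp]:
  assumes "A \<in> carrier_mat m n"
  shows "dim_row (lawrence_lifting r A) = r * m + n" "dim_col (lawrence_lifting r A) = r * n"
  using assms by (auto simp: lawrence_lifting_def append_rows_def dim_diag_block_mat sum_list_replicate)

lemma sum_over_blocks:
  fixes F :: "nat \<Rightarrow> int"
  shows "(\<Sum>k<r * n. F k) = (\<Sum>i<r. \<Sum>j<n. F (i * n + j))"
proof -
  have "sum F {i * n..<i * n + n} = (\<Sum>j<n. F (i * n + j))" for i
    using sum.shift_bounds_nat_ivl[of F 0 "i * n" n] by (simp add: add.commute atLeast0LessThan)
  then show ?thesis using sum.nat_group[of F n r] by simp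
qed

lemma lawrence_lifting_mult_block:
  assumes A: "A \<in> carrier_mat m n" and x: "dim_vec x = r * n" and i: "i < r" and k: "k < m"
  shows "(lawrence_lifting r A *\<^sub>v x) $ (i * m + k) = (A *\<^sub>v block n x i) $ k"
proof -
  let ?L = "lawrence_lifting r A"
  have ik: "i * m + k < r * m" using block_index_less[OF i k] .
  have entry: "?L $$ (i * m + k, i' * n + j) = (if i' = i then A $$ (k, j) else 0)"
    if "i' < r" "j < n" for i' j
    using that ik k A block_index_less[OF that]
      diag_block_mat_replicate_index[OF A ik block_index_less[OF that]]
    by (auto simp: lawrence_lifting_def append_rows_def dim_diag_block_mat sum_list_replicate)
  have "(?L *\<^sub>v x) $ (i * m + k) = (\<Sum>l<r * n. ?L $$ (i * m + k, l) * x $ l)"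
    using ik A x by (simp add: scalar_prod_def atLeast0LessThan)
  also have "\<dots> = (\<Sum>i'<r. \<Sum>j<n. ?L $$ (i * m + k, i' * n + j) * x $ (i' * n + j))"
    by (rule sum_over_blocks)
  also have "\<dots> = (\<Sum>i'<r. if i' = i then \<Sum>j<n. A $$ (k, j) * x $ (i * n + j) else 0)"
    by (intro sum.cong) (auto simp: entry)
  also have "\<dots> = (\<Sum>j<n. A $$ (k, j) * x $ (i * n + j))" using i by simp
  also have "\<dots> = (A *\<^sub>v block n x i) $ k"
    using A k by (simp add: scalar_prod_def block_def atLeast0LessThan)
  finally show ?thesis .
qed

lemma lawrence_lifting_mult_column:
  assumes A: "A \<in> carrier_mat m n" and x: "dim_vec x = r * n" and j: "j < n"
  shows "(lawrence_lifting r A *\<^sub>v x) $ (r * m + j) = (\<Sum>i<r. x $ (i * n + j))"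
proof -
  let ?L = "lawrence_lifting r A"
  have entry: "?L $$ (r * m + j, i * n + j') = (if j' = j then 1 else 0)"
    if "i < r" "j' < n" for i j'
    using that j A block_index_less[OF that]
    by (auto simp: lawrence_lifting_def append_rows_def dim_diag_block_mat sum_list_replicate)
  have "(?L *\<^sub>v x) $ (r * m + j) = (\<Sum>l<r * n. ?L $$ (r * m + j, l) * x $ l)"
    using j A x by (simp add: scalar_prod_def atLeast0LessThan)
  also have "\<dots> = (\<Sum>i<r. \<Sum>j'<n. ?L $$ (r * m + j, i * n + j') * x $ (i * n + j'))"
    by (rule sum_over_blocks)
  also have "\<dots> = (\<Sum>i<r. \<Sum>j'<n. if j' = j then x $ (i * n + j) else 0)"
    by (intro sum.cong) (auto simp: entry)
  also have "\<dots> = (\<Sum>i<r. x $ (i * n + j))" using j by simp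
  finally show ?thesis .
qed

lemma mat_kernel_lawrence_lifting:
  assumes A: "A \<in> carrier_mat m n"
  shows "x \<in> mat_kernel (lawrence_lifting r A) \<longleftrightarrow>
     dim_vec x = r * n \<and> (\<forall>i<r. block n x i \<in> mat_kernel A) \<and>
     (\<forall>j<n. (\<Sum>i<r. x $ (i * n + j)) = 0)"
proof (cases "dim_vec x = r * n")
  case False
  then show ?thesis using A by (auto simp: mat_kernel_def)
next
  case x: True
  let ?y = "lawrence_lifting r A *\<^sub>v x"
  have "(\<forall>k<r * m + n. ?y $ k = 0)
      \<longleftrightarrow> (\<forall>i<r. \<forall>k<m. ?y $ (i * m + k) = 0) \<and> (\<forall>j<n. ?y $ (r * m + j) = 0)"
    (is "?all = ?split")
  proof
    show ?all if ?split
    proof (intro allI impI)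
      fix k assume k: "k < r * m + n"
      show "?y $ k = 0"
      proof (cases "k < r * m")
        case True
        then show ?thesis using that block_index_div[OF True] by (metis div_mult_mod_eq)
      next
        case False
        then obtain j where "k = r * m + j" using le_Suc_ex not_less by blast
        then show ?thesis using that k by simp
      qed
    qed
  qed (auto dest: block_index_less)
  also have "\<dots> \<longleftrightarrow> (\<forall>i<r. \<forall>k<m. (A *\<^sub>v block n x i) $ k = 0)
        \<and> (\<forall>j<n. (\<Sum>i<r. x $ (i * n + j)) = 0)"
    by (simp add: lawrence_lifting_mult_block[OF A x] lawrence_lifting_mult_column[OF A x])
  finally have *: "(\<forall>k<r * m + n. ?y $ k = 0) \<longleftrightarrow> \<dots>" .
  have "x \<in> mat_kernel (lawrence_lifting r A) \<longleftrightarrow> (\<forall>k<r * m + n. ?y $ k = 0)"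
    using A x by (simp add: mem_mat_kernel_iff del: index_mult_mat_vec)
  moreover have "block n x i \<in> mat_kernel A \<longleftrightarrow> (\<forall>k<m. (A *\<^sub>v block n x i) $ k = 0)" for i
    using A by (simp add: mem_mat_kernel_iff block_def del: index_mult_mat_vec)
  ultimately show ?thesis using * x by simp
qed

lemma nonneg_block:
  assumes "0\<^sub>v (r * n) \<le> y" "i < r"
  shows "0\<^sub>v n \<le> block n y i"
  using assms block_index_less[of i r _ n] by (auto simp: less_eq_vec_def block_def)

lemma vec_of_blocks_eqI:
  assumes "dim_vec y = r * n" "\<And>i. i < r \<Longrightarrow> block n y i = f i"
  shows "y = vec_of_blocks r n f"
proof (rule eq_vecI)
  fix k assume "k < dim_vec (vec_of_blocks r n f)"
  then have k: "k < r * n" by simp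
  then have i: "k div n < r" and j: "k mod n < n" using block_index_div by auto
  have "y $ k = block n y (k div n) $ (k mod n)" using j by (simp add: block_def)
  then show "y $ k = vec_of_blocks r n f $ k" using assms(2)[OF i] k by (simp add: vec_of_blocks_def)
qed (use assms in simp)

text \<open>
  A point \<open>y\<close> of the fiber has in each row \<open>i\<close> one of the two vectors \<open>g i\<close>, \<open>h i\<close>. The rows
  in which \<open>y\<close> differs from \<open>g\<close> form a set \<open>S\<close> whose differences sum to zero, because \<open>y\<close>
  and \<open>g\<close> have equal column sums. Minimality leaves only the empty and the full \<open>S\<close>.
\<close>

lemma two_element_fiber_lawrence_lifting:
  assumes A: "A \<in> carrier_mat m n"
    and fib: "\<And>i. i < r \<Longrightarrow> fiber A (g i) = {g i, h i}"
    and nonneg: "\<And>i. i < r \<Longrightarrow> 0\<^sub>v n \<le> g i"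
    and zero: "\<And>j. j < n \<Longrightarrow> (\<Sum>i<r. g i $ j - h i $ j) = 0"
    and min: "\<And>S. S \<subseteq> {..<r} \<Longrightarrow> (\<And>j. j < n \<Longrightarrow> (\<Sum>i\<in>S. g i $ j - h i $ j) = 0)
                \<Longrightarrow> S = {} \<or> S = {..<r}"
  shows "fiber (lawrence_lifting r A) (vec_of_blocks r n g)
         = {vec_of_blocks r n g, vec_of_blocks r n h}"
proof -
  let ?p = "vec_of_blocks r n g" and ?u = "vec_of_blocks r n h"
  have h: "0\<^sub>v n \<le> h i" "g i - h i \<in> mat_kernel A" if "i < r" for i
    using fib[OF that] A by (auto simp: fiber_def)
  have dg: "dim_vec (g i) = n" if "i < r" for i
    using nonneg[OF that] by (auto simp: less_eq_vec_def)
  have dh: "dim_vec (h i) = n" if "i < r" for i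
    using h(1)[OF that] by (auto simp: less_eq_vec_def)
  have nonneg_blocks: "0\<^sub>v (r * n) \<le> vec_of_blocks r n f"
    if f: "\<And>i. i < r \<Longrightarrow> 0\<^sub>v n \<le> f i" for f
  proof -
    have "0 \<le> f (k div n) $ (k mod n)" if "k < r * n" for k
      using f[of "k div n"] block_index_div[OF that] by (auto simp: less_eq_vec_def)
    then show ?thesis by (auto simp: less_eq_vec_def vec_of_blocks_def)
  qed
  have block_diff: "block n (?p - y) i = g i - block n y i" if "i < r" "dim_vec y = r * n" for i y
    using that dg block_index_less[of i r _ n] by (intro eq_vecI) (auto simp: block_def)
  have fiber_iff: "y \<in> fiber (lawrence_lifting r A) ?p \<longleftrightarrow>
      0\<^sub>v (r * n) \<le> y \<and> (\<forall>i<r. g i - block n y i \<in> mat_kernel A) \<and>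
      (\<forall>j<n. (\<Sum>i<r. g i $ j - block n y i $ j) = 0)" for y
  proof (cases "0\<^sub>v (r * n) \<le> y")
    case True
    then have dy: "dim_vec y = r * n" by (auto simp: less_eq_vec_def)
    have col: "(\<Sum>i<r. (?p - y) $ (i * n + j)) = (\<Sum>i<r. g i $ j - block n y i $ j)" if "j < n" for j
      using that dy block_index_less[of _ r j n] by (intro sum.cong) (auto simp: block_def)
    show ?thesis
      using A True dy by (auto simp: fiber_def mat_kernel_lawrence_lifting[OF A] block_diff col)
  next
    case False
    then show ?thesis using A by (simp add: fiber_def)
  qed
  have block_id: "block n (vec_of_blocks r n f) i = f i" if "i < r" "dim_vec (f i) = n" for f i
    using that by (intro eq_vecI) (auto simp: block_def)
  show ?thesis
  proof (intro equalityI subsetI)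
    fix y assume "y \<in> fiber (lawrence_lifting r A) ?p"
    then have y: "0\<^sub>v (r * n) \<le> y" "\<And>i. i < r \<Longrightarrow> g i - block n y i \<in> mat_kernel A"
      "\<And>j. j < n \<Longrightarrow> (\<Sum>i<r. g i $ j - block n y i $ j) = 0"
      by (auto simp: fiber_iff)
    have blocks: "block n y i = g i \<or> block n y i = h i" if "i < r" for i
    proof -
      have "block n y i \<in> fiber A (g i)"
        using y(2)[OF that] nonneg_block[OF y(1) that] A by (simp add: fiber_def)
      then show ?thesis using fib[OF that] by simp
    qed
    define S where "S = {i \<in> {..<r}. block n y i \<noteq> g i}"
    have S: "block n y i = h i" if "i \<in> S" for i
      using that blocks[of i] by (simp add: S_def)
    have "(\<Sum>i\<in>S. g i $ j - h i $ j) = 0" if "j < n" for j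
    proof -
      have "(\<Sum>i\<in>S. g i $ j - h i $ j) = (\<Sum>i<r. g i $ j - block n y i $ j)"
      proof (rule sum.mono_neutral_cong_left)
        show "\<forall>i\<in>{..<r} - S. g i $ j - block n y i $ j = 0" by (simp add: S_def)
        show "S \<subseteq> {..<r}" by (auto simp: S_def)
      qed (simp_all add: S)
      then show ?thesis using y(3)[OF that] by simp
    qed
    then have "S = {} \<or> S = {..<r}" by (intro min) (auto simp: S_def)
    moreover have dy: "dim_vec y = r * n" using y(1) by (auto simp: less_eq_vec_def)
    moreover have "y = ?p" if "S = {}"
      using that by (intro vec_of_blocks_eqI dy) (auto simp: S_def)
    moreover have "y = ?u" if "S = {..<r}"
    proof (intro vec_of_blocks_eqI dy)
      fix i assume "i < r"
      then have "i \<in> S" using that by simp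
      then show "block n y i = h i" by (rule S)
    qed
    ultimately show "y \<in> {?p, ?u}" by blast
  next
    have "g i - g i \<in> mat_kernel A" if "i < r" for i
      using fib[OF that] by (auto simp: fiber_def)
    then have "?p \<in> fiber (lawrence_lifting r A) ?p"
      using dg nonneg nonneg_blocks[of g] by (simp add: fiber_iff block_id)
    moreover have "?u \<in> fiber (lawrence_lifting r A) ?p"
      using dh h zero nonneg_blocks[of h] by (simp add: fiber_iff block_id)
    ultimately show "y \<in> fiber (lawrence_lifting r A) ?p" if "y \<in> {?p, ?u}" for y
      using that by blast
  qed
qed

section \<open>Bresinsky's curves\<close>

lemma curve_matrix_carrier: "curve_matrix a \<in> carrier_mat 1 (length a)"
  by (simp add: curve_matrix_def mat_of_rows_list_def)

lemma mat_kernel_curve_matrix: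
  "x \<in> mat_kernel (curve_matrix a) \<longleftrightarrow>
     dim_vec x = length a \<and> (\<Sum>j<length a. a ! j * x $ j) = 0"
  by (auto simp: mem_mat_kernel_iff curve_matrix_def mat_of_rows_list_def scalar_prod_def
      atLeast0LessThan)

text \<open>
  The index one is written \<open>Suc 0\<close> in the lemmas below, since this is its simplifier normal form.
\<close>

definition vec4 :: "int \<Rightarrow> int \<Rightarrow> int \<Rightarrow> int \<Rightarrow> int vec" where
  "vec4 x y z t = vec_of_list [x, y, z, t]"

lemma vec4_simps [simp]:
  "dim_vec (vec4 x y z t) = 4"
  "vec4 x y z t $ 0 = x" "vec4 x y z t $ Suc 0 = y" "vec4 x y z t $ 2 = z" "vec4 x y z t $ 3 = t"
  by (simp_all add: vec4_def vec_of_list_index numeral_2_eq_2 numeral_3_eq_3)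

lemma all_less_4: "(\<forall>j<4. P j) \<longleftrightarrow> P 0 \<and> P (Suc 0) \<and> P 2 \<and> P (3::nat)"
  by (auto simp: less_Suc_eq numeral_eq_Suc)

lemma sum_less_4: "(\<Sum>j<4. f j) = f 0 + f (Suc 0) + f 2 + (f (3::nat) :: int)"
  by (simp add: numeral_eq_Suc)

lemma vec4_collapse: "dim_vec v = 4 \<Longrightarrow> v = vec4 (v $ 0) (v $ Suc 0) (v $ 2) (v $ 3)"
proof (rule eq_vecI)
  have *: "\<forall>j<4. v $ j = vec4 (v $ 0) (v $ Suc 0) (v $ 2) (v $ 3) $ j"
    by (simp add: all_less_4)
  show "v $ j = vec4 (v $ 0) (v $ Suc 0) (v $ 2) (v $ 3) $ j"
    if "j < dim_vec (vec4 (v $ 0) (v $ Suc 0) (v $ 2) (v $ 3))" for j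
    by (rule *[rule_format]) (use that in simp)
qed simp

lemma nonneg_vec4:
  "0\<^sub>v 4 \<le> vec4 x y z t \<longleftrightarrow> 0 \<le> x \<and> 0 \<le> y \<and> 0 \<le> z \<and> 0 \<le> t"
  by (auto simp: less_eq_vec_def all_less_4)

lemma fiber_curve_matrix_vec4:
  "fiber (curve_matrix [a, b, c, d]) (vec4 x y z t) =
     {vec4 x' y' z' t' | x' y' z' t'. 0 \<le> x' \<and> 0 \<le> y' \<and> 0 \<le> z' \<and> 0 \<le> t' \<and>
        a * x' + b * y' + c * z' + d * t' = a * x + b * y + c * z + d * t}" (is "?F = ?R")
proof -
  have dim: "dim_col (curve_matrix [a, b, c, d]) = 4"
    using curve_matrix_carrier[of "[a, b, c, d]"] by simp
  have mem: "vec4 x' y' z' t' \<in> ?F \<longleftrightarrow> 0 \<le> x' \<and> 0 \<le> y' \<and> 0 \<le> z' \<and> 0 \<le> t' \<and>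
        a * x' + b * y' + c * z' + d * t' = a * x + b * y + c * z + d * t" for x' y' z' t'
    unfolding fiber_def mat_kernel_curve_matrix dim
    by (auto simp: nonneg_vec4 sum_less_4 algebra_simps simp flip: numeral_2_eq_2 numeral_3_eq_3)
  have "\<exists>x' y' z' t'. v = vec4 x' y' z' t'" if "v \<in> ?F" for v
  proof -
    have "dim_vec v = 4" using that dim by (auto simp: fiber_def less_eq_vec_def)
    then show ?thesis using vec4_collapse by blast
  qed
  then show ?thesis using mem by blast
qed

definition bresinsky :: "int \<Rightarrow> int list" where
  "bresinsky q = [q * (q + 1), (q - 1) * (q + 1), q * (q + 1) + (q - 1), q * (q - 1)]"

lemma monomial_curve_bresinsky:
  assumes "4 \<le> q"
  shows "monomial_curve 4 (bresinsky q)"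
proof -
  have "4 * 4 \<le> q * q" using assms by (intro mult_mono) auto
  then show ?thesis using assms
    by (auto simp: monomial_curve_def bresinsky_def algebra_simps)
qed

text \<open>
  Modulo \<open>q - 1\<close> the four entries of the curve are \<open>2, 0, 2, 0\<close>, so the degree determines
  \<open>2 (x + z)\<close>; since \<open>q\<close> is even, the factor \<open>2\<close> can be cancelled.
\<close>

lemma first_and_third_exponent:
  fixes q :: int
  assumes "even q"
    and "(q * (q + 1)) * x + ((q - 1) * (q + 1)) * y + (q * (q + 1) + (q - 1)) * z + (q * (q - 1)) * t
         = (q - 1) * s + 2 * e"
  shows "(q - 1) dvd x + z - e"
proof -
  have "2 * (x + z - e) = (q - 1) * (s - ((q + 2) * x + (q + 1) * y + (q + 3) * z + q * t))"
    using assms(2) by (simp add: algebra_simps)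
  then have "(q - 1) dvd 2 * (x + z - e)" by simp
  moreover have "coprime (q - 1) 2" using assms(1) by simp
  ultimately show ?thesis using coprime_dvd_mult_right_iff by blast
qed

text \<open>
  The degree is divisible by \<open>q - 1\<close> and too small for \<open>x + z \<ge> 2 (q - 1)\<close>, so
  \<open>x + z\<close> is \<open>0\<close> or \<open>q - 1\<close>. Dividing the equation by \<open>q - 1\<close> leaves
  \<open>(q + 1) y + q t = q (q + 1) + i\<close> in the first case and
  \<open>z + (q + 1) y + q t = i\<close> in the second; as \<open>1 \<le> i < q\<close>, each has exactly one solution.
\<close>

lemma bresinsky_degree_solutions:
  fixes q :: int
  assumes q: "4 \<le> q" "even q" and i: "1 \<le> i" "i \<le> q - 1"
    and nn: "0 \<le> x" "0 \<le> y" "0 \<le> z" "0 \<le> t"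
    and deg: "(q * (q + 1)) * x + ((q - 1) * (q + 1)) * y + (q * (q + 1) + (q - 1)) * z + (q * (q - 1)) * t
         = q * (q + 1) * (q - 1) + i * (q - 1)"
  shows "(x, y, z, t) = (q - 1 - i, 0, i, 0) \<or> (x, y, z, t) = (0, i, 0, q + 1 - i)"
proof -
  have "(q - 1) dvd x + z - 0"
    by (rule first_and_third_exponent[OF q(2), where y = y and t = t and s = "q * (q + 1) + i"])
      (use deg in \<open>simp add: algebra_simps\<close>)
  then obtain k where k: "x + z = (q - 1) * k" by (auto elim: dvdE)
  have k0: "0 \<le> k" using k nn q by (smt (verit) mult_pos_neg)
  have k2: "k < 2"
  proof (rule ccontr)
    assume "\<not> k < 2"
    then have "(q - 1) * 2 \<le> (q - 1) * k" using q by (intro mult_left_mono) auto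
    then have "2 * (q - 1) \<le> x + z" using k by simp
    then have "(q * (q + 1)) * (2 * (q - 1)) \<le> (q * (q + 1)) * (x + z)"
      using q by (intro mult_left_mono) auto
    moreover have "0 \<le> ((q - 1) * (q + 1)) * y" "0 \<le> (q - 1) * z" "0 \<le> (q * (q - 1)) * t"
      using nn q by auto
    moreover have "i * (q - 1) < q * (q + 1) * (q - 1)"
    proof (rule mult_strict_right_mono)
      have "i < q * 1" using i by simp
      also have "\<dots> \<le> q * (q + 1)" using q by (intro mult_left_mono) auto
      finally show "i < q * (q + 1)" .
    qed (use q in simp)
    ultimately show False using deg by (simp add: algebra_simps)
  qed
  show ?thesis
  proof (cases "k = 0")
    case True
    then have x: "x = 0" "z = 0" using k nn by auto
    have "(q - 1) * ((q + 1) * y + q * t) = (q - 1) * (q * (q + 1) + i)"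
      using deg by (simp add: x algebra_simps)
    then have eq: "(q + 1) * y + q * t = q * (q + 1) + i" using q by simp
    then have "y - i = q * (q + 1 - y - t)" by (simp add: algebra_simps)
    then obtain l where l: "y = i + q * l" by (metis add.commute diff_add_cancel)
    have "0 \<le> l"
    proof (rule ccontr)
      assume "\<not> 0 \<le> l"
      then have "q * l \<le> q * (-1)" using q by (intro mult_left_mono) auto
      then show False using l nn i by simp
    qed
    moreover have "l < 1"
    proof (rule ccontr)
      assume "\<not> l < 1"
      then have "q * 1 \<le> q * l" using q by (intro mult_left_mono) auto
      then have "i + q \<le> y" using l by simp
      then have "(q + 1) * (i + q) \<le> (q + 1) * y" using q by (intro mult_left_mono) auto
      moreover have "0 \<le> q * t" "0 < q * i" using q nn i by auto
      ultimately show False using eq by (simp add: algebra_simps)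
    qed
    ultimately have "y = i" using l by simp
    then have "q * t = q * (q + 1 - i)" using eq by (simp add: algebra_simps)
    then show ?thesis using x \<open>y = i\<close> q by simp
  next
    case False
    then have "k = 1" using k0 k2 by simp
    then have x: "x = q - 1 - z" using k by simp
    have "(q - 1) * (z + (q + 1) * y + q * t) = (q - 1) * i"
      using deg by (simp add: x algebra_simps)
    then have eq: "z + (q + 1) * y + q * t = i" using q by simp
    have "y = 0"
    proof (rule ccontr)
      assume "y \<noteq> 0"
      then have "(q + 1) * 1 \<le> (q + 1) * y" using nn q by (intro mult_left_mono) auto
      then have "q + 1 \<le> (q + 1) * y" by (simp only: mult_1_right)
      moreover have "0 \<le> q * t" using nn q by simp
      ultimately show False using eq i nn by linarith
    qed
    moreover have "t = 0"
    proof (rule ccontr)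
      assume "t \<noteq> 0"
      then have "q * 1 \<le> q * t" using nn q by (intro mult_left_mono) auto
      then have "q \<le> q * t" by (simp only: mult_1_right)
      moreover have "0 \<le> (q + 1) * y" using nn q by simp
      ultimately show False using eq i nn by linarith
    qed
    ultimately show ?thesis using eq x by simp
  qed
qed

text \<open>
  By the same congruence \<open>x + z\<close> is \<open>1\<close> modulo \<open>q - 1\<close>, and the degree excludes
  \<open>x + z \<ge> 2\<close>. Dividing by \<open>q - 1\<close> leaves \<open>(q + 1) y + q t = q + 1\<close> if \<open>x = 1\<close> and
  \<open>(q + 1) y + q t = q\<close> if \<open>z = 1\<close>.
\<close>

lemma bresinsky_quadric_solutions:
  fixes q :: int
  assumes q: "4 \<le> q" "even q"
    and nn: "0 \<le> x" "0 \<le> y" "0 \<le> z" "0 \<le> t"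
    and deg: "(q * (q + 1)) * x + ((q - 1) * (q + 1)) * y + (q * (q + 1) + (q - 1)) * z + (q * (q - 1)) * t
         = q * (q + 1) + (q - 1) * (q + 1)"
  shows "(x, y, z, t) = (1, 1, 0, 0) \<or> (x, y, z, t) = (0, 0, 1, 1)"
proof -
  \<comment> \<open>the degree equals \<open>(q - 1) (2 q + 3) + 2\<close>\<close>
  have "(q - 1) dvd x + z - 1"
    by (rule first_and_third_exponent[OF q(2), where y = y and t = t and s = "2 * q + 3"])
      (use deg in \<open>simp add: algebra_simps\<close>)
  then obtain k where "x + z - 1 = (q - 1) * k" by (auto elim: dvdE)
  then have k: "x + z = 1 + (q - 1) * k" by simp
  have k0: "0 \<le> k"
  proof (rule ccontr)
    assume "\<not> 0 \<le> k"
    then have "(q - 1) * k \<le> (q - 1) * (-1)" using q by (intro mult_left_mono) auto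
    then show False using k nn q by simp
  qed
  have k1: "k < 1"
  proof (rule ccontr)
    assume "\<not> k < 1"
    then have "(q - 1) * 1 \<le> (q - 1) * k" using q by (intro mult_left_mono) auto
    then have "q - 1 \<le> (q - 1) * k" by (simp only: mult_1_right)
    then have "2 \<le> x + z" using k q by linarith
    then have "(q * (q + 1)) * 2 \<le> (q * (q + 1)) * (x + z)"
      using q by (intro mult_left_mono) auto
    moreover have "0 \<le> ((q - 1) * (q + 1)) * y" "0 \<le> (q - 1) * z" "0 \<le> (q * (q - 1)) * t"
      using nn q by auto
    moreover have "(q * (q + 1)) * (x + z) + ((q - 1) * (q + 1)) * y + (q - 1) * z + (q * (q - 1)) * t
        = (q * (q + 1)) * 2 - (q + 1)"
      using deg by (simp add: algebra_simps)
    ultimately show False using q by linarith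
  qed
  then have "k = 0" using k0 by simp
  then have "x = 1 \<and> z = 0 \<or> x = 0 \<and> z = 1" using k nn by auto
  then show ?thesis
  proof
    assume x: "x = 1 \<and> z = 0"
    have "(q - 1) * ((q + 1) * y + q * t) = (q - 1) * (q + 1)"
      using deg by (simp add: x algebra_simps)
    then have eq: "(q + 1) * y + q * t = q + 1" using q by simp
    then have "q * (y + t - 1) = 1 - y" by (simp add: algebra_simps)
    moreover have "y \<le> 1"
    proof (rule ccontr)
      assume "\<not> y \<le> 1"
      then have "(q + 1) * 2 \<le> (q + 1) * y" using q by (intro mult_left_mono) auto
      moreover have "0 \<le> q * t" using nn q by simp
      ultimately show False using eq q by simp
    qed
    ultimately have "q dvd 1 - y" "0 \<le> 1 - y" "1 - y < q" using nn q by (auto intro: dvdI[OF sym])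
    then have "y = 1" using zdvd_not_zless[of "1 - y" q] by (cases "y < 1") auto
    then show ?thesis using eq x q by simp
  next
    assume x: "x = 0 \<and> z = 1"
    have "(q - 1) * ((q + 1) * y + q * t) = (q - 1) * q"
      using deg by (simp add: x algebra_simps)
    then have eq: "(q + 1) * y + q * t = q" using q by simp
    have "y = 0"
    proof (rule ccontr)
      assume "y \<noteq> 0"
      then have "(q + 1) * 1 \<le> (q + 1) * y" using nn q by (intro mult_left_mono) auto
      moreover have "0 \<le> q * t" using nn q by simp
      ultimately show False using eq by simp
    qed
    then show ?thesis using eq x q by simp
  qed
qed

lemma bresinsky_fiber:
  assumes "4 \<le> q" "even q" "1 \<le> i" "i \<le> q - 1"
  shows "fiber (curve_matrix (bresinsky q)) (vec4 (q - 1 - i) 0 i 0)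
           = {vec4 (q - 1 - i) 0 i 0, vec4 0 i 0 (q + 1 - i)}" (is ?A)
    and "fiber (curve_matrix (bresinsky q)) (vec4 0 i 0 (q + 1 - i))
           = {vec4 0 i 0 (q + 1 - i), vec4 (q - 1 - i) 0 i 0}" (is ?B)
proof -
  let ?R = "{vec4 x y z t | x y z t. 0 \<le> x \<and> 0 \<le> y \<and> 0 \<le> z \<and> 0 \<le> t \<and>
    (q * (q + 1)) * x + ((q - 1) * (q + 1)) * y + (q * (q + 1) + (q - 1)) * z + (q * (q - 1)) * t
         = q * (q + 1) * (q - 1) + i * (q - 1)}"
  have "?R \<subseteq> {vec4 (q - 1 - i) 0 i 0, vec4 0 i 0 (q + 1 - i)}"
    using bresinsky_degree_solutions[OF assms] by blast
  moreover have "vec4 (q - 1 - i) 0 i 0 \<in> ?R"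
    using assms by (intro CollectI exI conjI) (rule refl, auto simp: algebra_simps)
  moreover have "vec4 0 i 0 (q + 1 - i) \<in> ?R"
    using assms by (intro CollectI exI conjI) (rule refl, auto simp: algebra_simps)
  ultimately have R: "?R = {vec4 (q - 1 - i) 0 i 0, vec4 0 i 0 (q + 1 - i)}" by blast
  have d1: "(q * (q + 1)) * (q - 1 - i) + ((q - 1) * (q + 1)) * 0 + (q * (q + 1) + (q - 1)) * i + (q * (q - 1)) * 0
         = q * (q + 1) * (q - 1) + i * (q - 1)" by (simp add: algebra_simps)
  have d2: "(q * (q + 1)) * 0 + ((q - 1) * (q + 1)) * i + (q * (q + 1) + (q - 1)) * 0 + (q * (q - 1)) * (q + 1 - i)
         = q * (q + 1) * (q - 1) + i * (q - 1)" by (simp add: algebra_simps)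
  show ?A unfolding bresinsky_def fiber_curve_matrix_vec4 d1 by (rule R)
  show ?B unfolding bresinsky_def fiber_curve_matrix_vec4 d2 using R by blast
qed

lemma bresinsky_quadric_fiber:
  assumes "4 \<le> q" "even q"
  shows "fiber (curve_matrix (bresinsky q)) (vec4 0 0 1 1) = {vec4 0 0 1 1, vec4 1 1 0 0}"
proof -
  let ?R = "{vec4 x y z t | x y z t. 0 \<le> x \<and> 0 \<le> y \<and> 0 \<le> z \<and> 0 \<le> t \<and>
    (q * (q + 1)) * x + ((q - 1) * (q + 1)) * y + (q * (q + 1) + (q - 1)) * z + (q * (q - 1)) * t
         = q * (q + 1) + (q - 1) * (q + 1)}"
  have "?R \<subseteq> {vec4 0 0 1 1, vec4 1 1 0 0}"
    using bresinsky_quadric_solutions[OF assms] by blast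
  moreover have "vec4 0 0 1 1 \<in> ?R" "vec4 1 1 0 0 \<in> ?R"
    by (intro CollectI exI conjI, rule refl, auto simp: algebra_simps)+
  ultimately have R: "?R = {vec4 0 0 1 1, vec4 1 1 0 0}" by blast
  have d: "(q * (q + 1)) * 0 + ((q - 1) * (q + 1)) * 0 + (q * (q + 1) + (q - 1)) * 1 + (q * (q - 1)) * 1
         = q * (q + 1) + (q - 1) * (q + 1)" by (simp add: algebra_simps)
  show ?thesis unfolding bresinsky_def fiber_curve_matrix_vec4 d by (rule R)
qed

section \<open>An indispensable element of large type\<close>

text \<open>
  The differences \<open>source_row q i - target_row q i\<close> are \<open>g\<^sub>1\<close> for \<open>i = 0\<close>, \<open>- g\<^bsub>q-1\<^esub>\<close> for
  \<open>i = 1\<close>, and \<open>- e\<close> for all other \<open>i\<close>.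
\<close>

definition source_row :: "int \<Rightarrow> nat \<Rightarrow> int vec" where
  "source_row q i = (if i = 0 then vec4 (q - 2) 0 1 0
                     else if i = 1 then vec4 0 (q - 1) 0 2 else vec4 0 0 1 1)"

definition target_row :: "int \<Rightarrow> nat \<Rightarrow> int vec" where
  "target_row q i = (if i = 0 then vec4 0 1 0 q
                     else if i = 1 then vec4 0 0 (q - 1) 0 else vec4 1 1 0 0)"

lemma source_row_fiber:
  assumes "4 \<le> q" "even q"
  shows "fiber (curve_matrix (bresinsky q)) (source_row q i) = {source_row q i, target_row q i}"
  using bresinsky_fiber(1)[OF assms, of 1] bresinsky_fiber(2)[OF assms, of "q - 1"]
    bresinsky_quadric_fiber[OF assms] assms
  by (auto simp: source_row_def target_row_def)

lemma sum_first_two_exceptional: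
  fixes a b c :: int
  assumes "finite S"
  shows "(\<Sum>i\<in>S. if i = (0::nat) then a else if i = 1 then b else c)
         = of_bool (0 \<in> S) * a + of_bool (1 \<in> S) * b + int (card (S - {0, 1})) * c"
proof -
  have "(\<Sum>i\<in>S. if i = 0 then a else if i = 1 then b else c)
     = (\<Sum>i\<in>S \<inter> {0, 1}. if i = 0 then a else b) + (\<Sum>i\<in>S - {0, 1}. c)"
    by (subst sum.Int_Diff[OF assms, of _ "{0, 1}"]) (intro arg_cong2[where f = "(+)"] sum.cong, auto)
  moreover have "(\<Sum>i\<in>S \<inter> {0, 1}. if i = 0 then a else b) = of_bool (0 \<in> S) * a + of_bool (1 \<in> S) * b"
    by (cases "0 \<in> S"; cases "Suc 0 \<in> S") (auto simp: Int_insert_right)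
  ultimately show ?thesis by simp
qed

lemma row_difference_sums:
  assumes "finite S"
  shows "(\<Sum>i\<in>S. source_row q i $ 0 - target_row q i $ 0)
           = of_bool (0 \<in> S) * (q - 2) - int (card (S - {0, 1}))"
    and "(\<Sum>i\<in>S. source_row q i $ Suc 0 - target_row q i $ Suc 0)
           = - of_bool (0 \<in> S) + of_bool (1 \<in> S) * (q - 1) - int (card (S - {0, 1}))"
    and "(\<Sum>i\<in>S. source_row q i $ 2 - target_row q i $ 2)
           = of_bool (0 \<in> S) - of_bool (1 \<in> S) * (q - 1) + int (card (S - {0, 1}))"
    and "(\<Sum>i\<in>S. source_row q i $ 3 - target_row q i $ 3)
           = - of_bool (0 \<in> S) * q + of_bool (1 \<in> S) * 2 + int (card (S - {0, 1}))"
proof -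
  have "(\<Sum>i\<in>S. source_row q i $ j - target_row q i $ j)
      = (\<Sum>i\<in>S. if i = 0 then (vec4 (q - 2) 0 1 0 $ j - vec4 0 1 0 q $ j) else
          if i = 1 then (vec4 0 (q - 1) 0 2 $ j - vec4 0 0 (q - 1) 0 $ j)
          else vec4 0 0 1 1 $ j - vec4 1 1 0 0 $ j)" for j
    by (intro sum.cong) (auto simp: source_row_def target_row_def)
  note * = this[unfolded sum_first_two_exceptional[OF assms]]
  show "(\<Sum>i\<in>S. source_row q i $ 0 - target_row q i $ 0)
           = of_bool (0 \<in> S) * (q - 2) - int (card (S - {0, 1}))"
    and "(\<Sum>i\<in>S. source_row q i $ Suc 0 - target_row q i $ Suc 0)
           = - of_bool (0 \<in> S) + of_bool (1 \<in> S) * (q - 1) - int (card (S - {0, 1}))"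
    and "(\<Sum>i\<in>S. source_row q i $ 2 - target_row q i $ 2)
           = of_bool (0 \<in> S) - of_bool (1 \<in> S) * (q - 1) + int (card (S - {0, 1}))"
    and "(\<Sum>i\<in>S. source_row q i $ 3 - target_row q i $ 3)
           = - of_bool (0 \<in> S) * q + of_bool (1 \<in> S) * 2 + int (card (S - {0, 1}))"
    by (simp_all add: *)
qed

text \<open>
  A subfamily with \<open>k\<close> copies of \<open>- e\<close> sums to zero in the first coordinate only if
  \<open>k = 0\<close> and \<open>g\<^sub>1\<close> is absent or \<open>k = q - 2\<close> and \<open>g\<^sub>1\<close> is present. The second
  coordinate, in which \<open>- g\<^bsub>q-1\<^esub>\<close> is \<open>q - 1\<close>, then decides whether \<open>- g\<^bsub>q-1\<^esub>\<close> occurs.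
\<close>

lemma rows_zero_sum_minimal:
  fixes N :: nat
  assumes N: "4 \<le> N" and S: "S \<subseteq> {..<N}"
    and sum: "\<And>j. j < 4 \<Longrightarrow> (\<Sum>i\<in>S. source_row (int N) i $ j - target_row (int N) i $ j) = 0"
  shows "S = {} \<or> S = {..<N}"
proof -
  have fin: "finite S" using S finite_subset by blast
  let ?k = "int (card (S - {0, 1}))"
  have c0: "of_bool (0 \<in> S) * (int N - 2) - ?k = 0"
    using sum[of 0] row_difference_sums(1)[OF fin, of "int N"] by simp
  have c1: "- of_bool (0 \<in> S) + of_bool (1 \<in> S) * (int N - 1) - ?k = 0"
    using sum[of "Suc 0"] row_difference_sums(2)[OF fin, of "int N"] by simp
  show ?thesis
  proof (cases "0 \<in> S")
    case False
    then have "card (S - {0, 1}) = 0" using c0 by simp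
    moreover have "1 \<notin> S" using False c0 c1 N by (auto split: if_splits)
    ultimately show ?thesis using False fin by auto
  next
    case True
    then have k: "card (S - {0, 1}) = N - 2" using c0 N by simp
    have "1 \<in> S" using True c0 c1 N by (cases "1 \<in> S") auto
    have "card ({..<N} - {0, 1}) = N - 2" using N by (subst card_Diff_subset) auto
    then have "S - {0, 1} = {..<N} - {0, 1}" using S k by (intro card_subset_eq) auto
    then show ?thesis using True \<open>1 \<in> S\<close> S by blast
  qed
qed

lemma rows_zero_sum:
  fixes N :: nat
  assumes N: "4 \<le> N" and j: "j < 4"
  shows "(\<Sum>i<N. source_row (int N) i $ j - target_row (int N) i $ j) = 0"
proof -
  have "card ({..<N} - {0, 1}) = N - 2" using N by (subst card_Diff_subset) auto
  then have "\<forall>j<4. (\<Sum>i<N. source_row (int N) i $ j - target_row (int N) i $ j) = 0"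
    unfolding all_less_4 using N by (simp add: row_difference_sums)
  then show ?thesis using j by blast
qed

lemma bresinsky_markov_complexity:
  fixes N :: nat
  assumes N: "4 \<le> N" "even N"
  shows "enat N \<le> markov_complexity (curve_matrix (bresinsky (int N)))"
proof -
  let ?A = "curve_matrix (bresinsky (int N))" and ?L = "lawrence_lifting N (curve_matrix (bresinsky (int N)))"
  let ?p = "vec_of_blocks N 4 (source_row (int N))" and ?u = "vec_of_blocks N 4 (target_row (int N))"
  have q: "4 \<le> int N" "even (int N)" using N by auto
  have A: "?A \<in> carrier_mat 1 4"
    using curve_matrix_carrier[of "bresinsky (int N)"] monomial_curve_bresinsky[OF q(1)]
    by (simp add: monomial_curve_def)
  have nonneg: "0\<^sub>v 4 \<le> source_row (int N) i" for i
    using N by (simp add: source_row_def nonneg_vec4)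
  have fib: "fiber ?L ?p = {?p, ?u}"
    by (rule two_element_fiber_lawrence_lifting[OF A source_row_fiber[OF q] nonneg
          rows_zero_sum[OF N(1)] rows_zero_sum_minimal[OF N(1)]])
  have differ: "source_row (int N) i \<noteq> target_row (int N) i" for i
  proof
    assume "source_row (int N) i = target_row (int N) i"
    then have "source_row (int N) i $ Suc 0 = target_row (int N) i $ Suc 0" by simp
    then show False using N by (auto simp: source_row_def target_row_def split: if_splits)
  qed
  have dims: "dim_vec (source_row (int N) i) = 4" "dim_vec (target_row (int N) i) = 4" for i
    by (simp_all add: source_row_def target_row_def)
  have entry: "\<exists>j<4. source_row (int N) i $ j \<noteq> target_row (int N) i $ j" for i
    using differ[of i] dims by (metis eq_vecI)
  have type: "lawrence_type N 4 v = N" if v: "v = ?p - ?u \<or> v = - (?p - ?u)" for v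
  proof -
    have "row (vec_as_mat N 4 v) i \<noteq> 0\<^sub>v 4" if "i < N" for i
    proof
      obtain j where j: "j < 4" "source_row (int N) i $ j \<noteq> target_row (int N) i $ j"
        using entry by blast
      assume "row (vec_as_mat N 4 v) i = 0\<^sub>v 4"
      then have "row (vec_as_mat N 4 v) i $ j = 0" using j by simp
      then have "v $ (i * 4 + j) = 0" using j that by (simp add: vec_as_mat_def)
      then show False using v j that block_index_less[OF that j(1)] by auto
    qed
    then have "{i. i < N \<and> row (vec_as_mat N 4 v) i \<noteq> 0\<^sub>v 4} = {..<N}" by blast
    then show ?thesis by (simp add: lawrence_type_def)
  qed
  have "?p \<in> fiber ?L ?p" using fib by simp
  then have p: "0\<^sub>v (dim_col ?L) \<le> ?p" by (simp add: fiber_def)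
  have ne: "?p \<noteq> ?u"
  proof
    assume eq: "?p = ?u"
    obtain j where j: "j < 4" "source_row (int N) 0 $ j \<noteq> target_row (int N) 0 $ j"
      using entry by blast
    have "source_row (int N) 0 $ j = ?p $ (0 * 4 + j)" "target_row (int N) 0 $ j = ?u $ (0 * 4 + j)"
      using j N by (simp_all only: vec_of_blocks_index)
    then show False using j eq by simp
  qed
  obtain B where B: "minimal_markov_basis ?L B" using minimal_markov_basis_exists by blast
  then have "markov_basis ?L B" by (simp add: minimal_markov_basis_def)
  from two_element_fiber_in_markov_basis[OF this p ne fib]
  obtain v where v: "v \<in> B" "v = ?p - ?u \<or> v = - (?p - ?u)" by blast
  have "v \<in> universal_markov_basis ?L" using B v(1) by (auto simp: universal_markov_basis_def)
  moreover have "lawrence_type N (dim_col ?A) v = N" using type[OF v(2)] A by simp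
  ultimately have "\<exists>r w. enat N = enat (lawrence_type r (dim_col ?A) w) \<and> 2 \<le> r \<and>
      w \<in> universal_markov_basis (lawrence_lifting r ?A)"
    using N(1) by (intro exI[of _ N] exI[of _ v]) auto
  then show ?thesis unfolding markov_complexity_def by (intro Sup_upper) simp
qed

theorem theorem4p1:
  shows "(\<forall>d::nat. \<exists>a. monomial_curve 4 a \<and> markov_complexity (curve_matrix a) > enat d) \<and>
         \<not> (\<exists>d::nat. \<forall>a. monomial_curve 4 a \<longrightarrow> markov_complexity (curve_matrix a) \<le> enat d)"
proof -
  have "\<exists>a. monomial_curve 4 a \<and> markov_complexity (curve_matrix a) > enat d" for d
  proof (intro exI conjI)
    let ?N = "2 * d + 4"
    show "monomial_curve 4 (bresinsky (int ?N))" by (rule monomial_curve_bresinsky) simp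
    have "enat d < enat ?N" by simp
    also have "\<dots> \<le> markov_complexity (curve_matrix (bresinsky (int ?N)))"
      by (rule bresinsky_markov_complexity) auto
    finally show "enat d < markov_complexity (curve_matrix (bresinsky (int ?N)))" .
  qed
  then show ?thesis by (meson not_le)
qed

end
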